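(* Let $G$ and $H$ be graphs with bounded degree which are quasi-isometric (as metric spaces with their combinatorial metrics), and let $\{f_n\}_{n\ge1}$ be a non-decreasing sequence of non-negative integers. If $G$ satisfies the $\{f_n\}$-containment property, then $H$ satisfies the $\{b_n\}$-containment property for some sequence $\{b_n\}$ with asymptotic growth equivalent to $\{f_n\}$.
   Context: The combinatorial metric on the vertex set of a graph is the length of a shortest path. A graph has bounded degree if there is a finite maximum vertex degree. Metric spaces $(X_1,d_1),(X_2,d_2)$ are quasi-isometric if there is a map $f\colon X_1\to X_2$ and constants $\lambda\ge1$, $\epsilon\ge0$, $c\ge0$ with $\frac1\lambda d_1(x,y)-\epsilon\le d_2(f(x),f(y))\le\lambda d_1(x,y)+\epsilon$ for all $x,y$ and every point of $X_2$ within distance $c$ of $f(X_1)$. For non-decreasing $f,g\colon\mathbb N\to\mathbb N$, write $f\preccurlyeq g$ if there is an integer $c>0$ with $f(n)\le c\,g(cn+c)+c$ for all $n\ge c$; $f$ and $g$ have equivalent asymptotic growth if $f\preccurlyeq g\preccurlyeq f$. Given a finite set $X_0$ of vertices, a sequence $\{W_k\}_{k\geq1}$ of vertex sets is an $\{f_n\}$-containment strategy for $X_0$ if: (1) $|W_n|\le f_n$ for all $n\ge1$; (2) $X_n\cap W_{n+1}=\emptyset$ for all $n\ge0$, where for $n>0$, $X_n$ is the set of vertices connected to a vertex of $X_{n-1}$ by a path of length at most $1$ containing no vertex of $W_1\cup\cdots\cup W_n$; (3) there is $N>0$ with $X_n=X_N$ for all $n\ge N$. A graph has the $\{f_n\}$-containment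 property if every finite vertex set admits such a strategy. *)

theory Defs
  imports
    "Graph_Theory.Digraph_Component"
    "HOL-Analysis.Abstract_Metric_Spaces"
begin

text \<open>
  Following \<^theory>\<open>Graph_Theory.Digraph\<close>, an undirected graph is a symmetric digraph: an edge
  is a pair of opposite arcs.  This is the library's locale \<^locale>\<open>graph\<close> without its
  finiteness assumption.
\<close>

locale simple_graph = loopfree_digraph + nomulti_digraph + sym_digraph

text \<open>
  The out-degree of a vertex is its degree, since every edge at the vertex contributes exactly
  one outgoing arc.  Finiteness is required separately because
  \<^const>\<open>out_degree\<close> is a \<^const>\<open>card\<close>, which is 0 on infinite sets.
\<close>

definition bounded_degree :: "('a, 'b) pre_digraph \<Rightarrow> bool" where
  "bounded_degree G \<longleftrightarrow>
     (\<exists>D. \<forall>v \<in> verts G. finite (out_arcs G v) \<and> out_degree G v \<le> D)"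

definition graph_dist :: "('a, 'b) pre_digraph \<Rightarrow> 'a \<Rightarrow> 'a \<Rightarrow> real" where
  "graph_dist G u v = real (LEAST n. \<exists>p. pre_digraph.apath G u p v \<and> length p = n)"

text \<open>The value of \<^const>\<open>graph_dist\<close> is meaningful only between connected vertices.\<close>

lemma (in simple_graph) graph_dist_awalk:
  "graph_dist G u v = real (LEAST n. \<exists>p. awalk u p v \<and> length p = n)" (is "_ = real ?m")
proof (cases "\<exists>p. awalk u p v")
  case True
  then have ex: "\<exists>n p. awalk u p v \<and> length p = n" by blast
  obtain p where p: "awalk u p v" "length p = ?m"
    using LeastI_ex[OF ex] by blast
  have ap: "apath u (awalk_to_apath p) v"
    using p by (simp add: apath_awalk_to_apath)
  then have "distinct (awalk_to_apath p)"
    by (auto simp: apath_def intro: distinct_verts_imp_distinct)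
  then have "length (awalk_to_apath p) = card (set (awalk_to_apath p))"
    by (simp add: distinct_card)
  then have "length (awalk_to_apath p) \<le> ?m"
    using card_mono[OF _ awalk_to_apath_subset[OF p(1)]] card_length[of p] p(2)
    by (metis List.finite_set le_trans)
  moreover have "?m \<le> length (awalk_to_apath p)"
    using ap by (intro Least_le) (auto simp: apath_def)
  ultimately have "\<exists>q. apath u q v \<and> length q = ?m"
    using ap by (metis le_antisym)
  moreover have "?m \<le> n" if "\<exists>q. apath u q v \<and> length q = n" for n
    using that by (intro Least_le) (auto simp: apath_def)
  ultimately have "(LEAST n. \<exists>p. apath u p v \<and> length p = n) = ?m"
    by (rule Least_equality)
  then show ?thesis by (simp add: graph_dist_def)
next
  case False
  then show ?thesis by (simp add: graph_dist_def apath_def)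
qed

lemma (in simple_graph) awalk_reverse:
  "awalk u p v \<Longrightarrow> \<exists>q. awalk v q u \<and> length q = length p"
proof (induction p arbitrary: u)
  case Nil
  then show ?case by (auto simp: awalk_Nil_iff)
next
  case (Cons e p)
  then have e: "e \<in> arcs G" "tail G e = u" and "awalk (head G e) p v"
    by (auto simp: awalk_Cons_iff)
  with Cons.IH obtain q where q: "awalk v q (head G e)" "length q = length p" by blast
  obtain e' where "e' \<in> arcs G" "tail G e' = head G e" "head G e' = u"
    using sym_arcs e unfolding symmetric_conv by metis
  then have "awalk (head G e) [e'] u" using arc_implies_awalk[of e'] by simp
  with q(1) have "awalk v (q @ [e']) u" by (rule awalk_appendI)
  with q show ?case by (intro exI[of _ "q @ [e']"]) simp
qed

lemma (in simple_graph) Metric_space_graph_dist: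
  assumes "Digraph_Component.connected G"
  shows "Metric_space (verts G) (graph_dist G)"
proof -
  let ?d = "\<lambda>u v. LEAST n. \<exists>p. awalk u p v \<and> length p = n"
  have ex: "\<exists>p. awalk u p v \<and> length p = ?d u v" if "u \<in> verts G" "v \<in> verts G" for u v
  proof -
    have "arcs_ends (with_proj (mk_symmetric G)) \<subseteq> arcs_ends G"
      using sym_arcs unfolding symmetric_def sym_def
      by (auto simp: parcs_mk_symmetric arcs_ends_conv)
    with assms that have "u \<rightarrow>\<^sup>* v"
      unfolding Digraph_Component.connected_def strongly_connected_def reachable_def
      by (auto intro: rtrancl_on_mono)
    then have "\<exists>n p. awalk u p v \<and> length p = n" by (simp add: reachable_awalk)
    then show ?thesis by (rule LeastI_ex)
  qed
  have le: "?d u v \<le> length p" if "awalk u p v" for u v p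
    using that by (auto intro: Least_le)
  have sym: "?d u v = ?d v u" for u v
  proof -
    have "(\<exists>p. awalk u p v \<and> length p = n) \<longleftrightarrow> (\<exists>p. awalk v p u \<and> length p = n)" for n
      using awalk_reverse by metis
    then show ?thesis by simp
  qed
  show ?thesis
  proof
    fix u v assume "u \<in> verts G" "v \<in> verts G"
    then show "graph_dist G u v = 0 \<longleftrightarrow> u = v"
      using ex[of u v] le[of u "[]" u]
      by (auto simp: graph_dist_awalk awalk_Nil_iff)
  next
    fix u v w assume uvw: "u \<in> verts G" "v \<in> verts G" "w \<in> verts G"
    obtain p where p: "awalk u p v" "length p = ?d u v"
      using ex[OF uvw(1,2)] by blast
    obtain q where q: "awalk v q w" "length q = ?d v w"
      using ex[OF uvw(2,3)] by blast
    have "?d u w \<le> ?d u v + ?d v w"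
      using le[OF awalk_appendI[OF p(1) q(1)]] p(2) q(2) by simp
    then show "graph_dist G u w \<le> graph_dist G u v + graph_dist G v w"
      by (simp add: graph_dist_awalk)
  next
    fix u v
    show "0 \<le> graph_dist G u v" by (simp add: graph_dist_def)
    show "graph_dist G u v = graph_dist G v u" using sym by (simp add: graph_dist_awalk)
  qed
qed

definition quasi_isometric ::
  "'a set \<Rightarrow> ('a \<Rightarrow> 'a \<Rightarrow> real) \<Rightarrow> 'c set \<Rightarrow> ('c \<Rightarrow> 'c \<Rightarrow> real) \<Rightarrow> bool" where
  "quasi_isometric X1 d1 X2 d2 \<longleftrightarrow>
     (\<exists>f \<in> X1 \<rightarrow> X2. \<exists>L::real. \<exists>\<epsilon>::real. \<exists>c::real. L \<ge> 1 \<and> \<epsilon> \<ge> 0 \<and> c \<ge> 0 \<and>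
        (\<forall>x \<in> X1. \<forall>y \<in> X1. 1 / L * d1 x y - \<epsilon> \<le> d2 (f x) (f y)
                             \<and> d2 (f x) (f y) \<le> L * d1 x y + \<epsilon>) \<and>
        (\<forall>z \<in> X2. \<exists>x \<in> X1. d2 z (f x) \<le> c))"

text \<open>
  Sequences indexed by \<open>n \<ge> 1\<close> are functions on \<^typ>\<open>nat\<close> whose value at 0 is
  ignored; since \<open>n \<ge> c > 0\<close> below, that value does not affect the growth preorder either.
\<close>

definition growth_le :: "(nat \<Rightarrow> nat) \<Rightarrow> (nat \<Rightarrow> nat) \<Rightarrow> bool" where
  "growth_le f g \<longleftrightarrow> (\<exists>c>0. \<forall>n\<ge>c. f n \<le> c * g (c * n + c) + c)"

definition growth_equivalent :: "(nat \<Rightarrow> nat) \<Rightarrow> (nat \<Rightarrow> nat) \<Rightarrow> bool" where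
  "growth_equivalent f g \<longleftrightarrow> growth_le f g \<and> growth_le g f"

text \<open>The set \<open>X\<^sub>n\<close> of vertices burning at time \<open>n\<close>.\<close>

primrec burning ::
  "('a, 'b) pre_digraph \<Rightarrow> (nat \<Rightarrow> 'a set) \<Rightarrow> 'a set \<Rightarrow> nat \<Rightarrow> 'a set" where
  "burning G W X0 0 = X0"
| "burning G W X0 (Suc n) =
     {v. \<exists>u \<in> burning G W X0 n. \<exists>p. pre_digraph.apath G u p v \<and> length p \<le> 1 \<and>
           set (pre_digraph.awalk_verts G u p) \<inter> (\<Union>k\<in>{1..Suc n}. W k) = {}}"

definition containment_strategy ::
  "('a, 'b) pre_digraph \<Rightarrow> (nat \<Rightarrow> nat) \<Rightarrow> 'a set \<Rightarrow> (nat \<Rightarrow> 'a set) \<Rightarrow> bool" where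
  "containment_strategy G f X0 W \<longleftrightarrow>
     (\<forall>n\<ge>1. W n \<subseteq> verts G \<and> finite (W n) \<and> card (W n) \<le> f n) \<and>
     (\<forall>n. burning G W X0 n \<inter> W (n + 1) = {}) \<and>
     (\<exists>N>0. \<forall>n\<ge>N. burning G W X0 n = burning G W X0 N)"

definition containment_property :: "('a, 'b) pre_digraph \<Rightarrow> (nat \<Rightarrow> nat) \<Rightarrow> bool" where
  "containment_property G f \<longleftrightarrow>
     (\<forall>X0. X0 \<subseteq> verts G \<and> finite X0 \<longrightarrow> (\<exists>W. containment_strategy G f X0 W))"

end

theory Submission
  imports Defs
begin

text \<open>
  Let \<open>\<psi>\<close> be a quasi-inverse from \<open>H\<close> to \<open>G\<close>: adjacent vertices of \<open>H\<close> have images joined by a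
  walk of length at most \<open>K\<close>, and the fibres of \<open>\<psi>\<close> have bounded size.  Let the fire in \<open>G\<close> start
  from the image of the initial fire in \<open>H\<close>, run \<open>K\<close> times as fast as the one in \<open>H\<close>, and be
  contained by a strategy \<open>W\<close>.  In the \<open>n\<close>-th step in \<open>H\<close> protect all vertices whose
  image is within distance \<open>K\<close> of the sets \<open>W\<^sub>j\<close> with \<open>K (n - 1) < j \<le> K n\<close>, except those whose
  image is already burning at time \<open>K (n - 1)\<close>.  By induction every vertex of \<open>H\<close> burning at time
  \<open>n\<close> has its image burning at time \<open>K n\<close>: a walk of length at most \<open>K\<close> that follows an edge of
  \<open>H\<close> and meets some \<open>W\<^sub>j\<close> leads to a vertex within distance \<open>K\<close> of \<open>W\<^sub>j\<close>, which is either
  protected or was already burning.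
\<close>

section \<open>Sizes of balls in graphs of bounded degree\<close>

text \<open>The iterate \<open>closed_nbhd G ^^ k\<close> serves as the ball of radius
  \<open>k\<close> around a set, in a form suited to counting by induction on
  \<open>k\<close>.\<close>

definition closed_nbhd :: "('a, 'b) pre_digraph \<Rightarrow> 'a set \<Rightarrow> 'a set" where
  "closed_nbhd G S = S \<union> head G ` (\<Union>u\<in>S. out_arcs G u)"

lemma closed_nbhd_iter_extensive: "S \<subseteq> (closed_nbhd G ^^ k) S"
  by (induction k) (auto simp: closed_nbhd_def)

text \<open>Each iteration multiplies the size by at most \<open>D + 1\<close>: a vertex contributes
  itself and at most \<open>D\<close> heads.\<close>

lemma closed_nbhd_iter_card:
  assumes "\<And>u. finite (out_arcs G u) \<and> card (out_arcs G u) \<le> D" "finite S"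
  shows "finite ((closed_nbhd G ^^ k) S) \<and> card ((closed_nbhd G ^^ k) S) \<le> (D + 1) ^ k * card S"
proof (induction k)
  case 0
  then show ?case using assms by simp
next
  case (Suc k)
  let ?T = "(closed_nbhd G ^^ k) S"
  from Suc have fin: "finite ?T" and le: "card ?T \<le> (D + 1) ^ k * card S" by auto
  have "card (\<Union>u\<in>?T. out_arcs G u) \<le> (\<Sum>u\<in>?T. card (out_arcs G u))"
    using fin by (rule card_UN_le)
  also have "\<dots> \<le> card ?T * D"
    using sum_bounded_above[of ?T "\<lambda>u. card (out_arcs G u)" D] assms(1) by simp
  finally have arcs: "card (\<Union>u\<in>?T. out_arcs G u) \<le> card ?T * D" .
  have finU: "finite (\<Union>u\<in>?T. out_arcs G u)" using fin assms(1) by blast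
  have "card (closed_nbhd G ?T) \<le> card ?T + card (head G ` (\<Union>u\<in>?T. out_arcs G u))"
    unfolding closed_nbhd_def by (rule card_Un_le)
  also have "\<dots> \<le> (D + 1) * card ?T"
    using card_image_le[OF finU, of "head G"] arcs by (simp add: algebra_simps)
  also have "\<dots> \<le> (D + 1) * ((D + 1) ^ k * card S)" using le by (rule mult_le_mono2)
  finally have "card (closed_nbhd G ?T) \<le> (D + 1) ^ Suc k * card S" by (simp only: power_Suc mult.assoc)
  moreover have "finite (closed_nbhd G ?T)" using finU fin by (simp add: closed_nbhd_def)
  ultimately show ?case by simp
qed

text \<open>Non-vertices have no outgoing arcs, so the bound extends to the whole type and later
  counts need no membership side conditions.\<close>

lemma bounded_degreeE:
  assumes "wf_digraph G" "bounded_degree G"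
  obtains D where "\<And>u. finite (out_arcs G u) \<and> card (out_arcs G u) \<le> D"
proof -
  interpret wf_digraph G by fact
  obtain D where D: "\<forall>v\<in>verts G. finite (out_arcs G v) \<and> out_degree G v \<le> D"
    using assms(2) by (auto simp: bounded_degree_def)
  have "finite (out_arcs G u) \<and> card (out_arcs G u) \<le> D" for u
  proof (cases "u \<in> verts G")
    case True
    then show ?thesis using D by (simp add: out_degree_def)
  next
    case False
    then have "out_arcs G u = {}" by (auto simp: out_arcs_def)
    then show ?thesis by simp
  qed
  then show ?thesis by (rule that)
qed

section \<open>Walks and the spread of the fire in a single graph\<close>

context simple_graph
begin

lemma awalk_in_closed_nbhd_iter:
  assumes "awalk u p v" "length p \<le> k" "u \<in> S"
  shows "v \<in> (closed_nbhd G ^^ k) S"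
  using assms
proof (induction p arbitrary: u k S)
  case Nil
  then show ?case using closed_nbhd_iter_extensive[of S k G] by (auto simp: awalk_Nil_iff)
next
  case (Cons e p)
  then obtain k' where k: "k = Suc k'" "length p \<le> k'" by (cases k) auto
  from Cons have e: "e \<in> arcs G" "tail G e = u" and w: "awalk (head G e) p v"
    by (auto simp: awalk_Cons_iff)
  have "head G e \<in> closed_nbhd G S" using e \<open>u \<in> S\<close> by (auto simp: closed_nbhd_def)
  \<comment> \<open>The first arc is absorbed by enlarging \<open>S\<close>, so the innermost
    application of the iterate is split off.\<close>
  from Cons.IH[OF w k(2) this] show ?case
    unfolding k(1) by (simp only: funpow_Suc_right o_apply)
qed

text \<open>Connectedness is stated for the symmetric closure, which adds no arcs to
  \<open>G\<close>; hence walks exist and the \<open>LEAST\<close> in \<open>graph_dist\<close> is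
  attained.\<close>

lemma connected_awalk_graph_dist:
  assumes "Digraph_Component.connected G" "u \<in> verts G" "v \<in> verts G"
  shows "\<exists>p. awalk u p v \<and> real (length p) = graph_dist G u v"
proof -
  have "arcs_ends (with_proj (mk_symmetric G)) \<subseteq> arcs_ends G"
    using sym_arcs unfolding symmetric_def sym_def
    by (auto simp: parcs_mk_symmetric arcs_ends_conv)
  with assms have "u \<rightarrow>\<^sup>* v"
    unfolding Digraph_Component.connected_def strongly_connected_def reachable_def
    by (auto intro: rtrancl_on_mono)
  then have "\<exists>n p. awalk u p v \<and> length p = n" by (simp add: reachable_awalk)
  from LeastI_ex[OF this] show ?thesis by (simp add: graph_dist_awalk)
qed

lemma graph_dist_adjacent_le:
  assumes "u \<rightarrow> v"
  shows "graph_dist G u v \<le> 1"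
proof -
  from assms obtain e where "e \<in> arcs G" "tail G e = u" "head G e = v" by auto
  then have "awalk u [e] v" using arc_implies_awalk by auto
  then have "(LEAST n. \<exists>p. awalk u p v \<and> length p = n) \<le> length [e]"
    by (intro Least_le) blast
  then show ?thesis by (simp add: graph_dist_awalk)
qed

text \<open>A path of length at most 1 is trivial or a single arc, and the absence of loops makes
  every single arc a path. Later arguments use this form in place of
  \<open>burning.simps(2)\<close>.\<close>

lemma burning_Suc_iff:
  "v \<in> burning G W X0 (Suc n) \<longleftrightarrow>
     (\<exists>u \<in> burning G W X0 n. (u = v \<and> u \<in> verts G \<or> u \<rightarrow> v) \<and>
        u \<notin> (\<Union>k\<in>{1..Suc n}. W k) \<and> v \<notin> (\<Union>k\<in>{1..Suc n}. W k))"
proof -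
  have short: "(\<exists>p. apath u p v \<and> length p \<le> 1 \<and> set (awalk_verts u p) \<inter> U = {}) \<longleftrightarrow>
      (u = v \<and> u \<in> verts G \<or> u \<rightarrow> v) \<and> u \<notin> U \<and> v \<notin> U" (is "?L \<longleftrightarrow> ?R") for u U
  proof
    assume ?L
    then obtain p where p: "apath u p v" "length p \<le> 1" "set (awalk_verts u p) \<inter> U = {}" by blast
    show ?R
    proof (cases p)
      case Nil
      then show ?thesis using p by (auto simp: apath_def awalk_Nil_iff)
    next
      case (Cons e q)
      with p show ?thesis
        by (auto simp: apath_def awalk_Cons_iff awalk_Nil_iff intro: in_arcs_imp_in_arcs_ends)
    qed
  next
    assume R: ?R
    then consider "u = v" "u \<in> verts G" | "u \<rightarrow> v" by blast
    then show ?L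
    proof cases
      case 1
      then show ?thesis using R by (intro exI[of _ "[]"]) (auto simp: apath_def awalk_Nil_iff)
    next
      case 2
      then obtain e where e: "e \<in> arcs G" "tail G e = u" "head G e = v" by auto
      moreover have "u \<noteq> v" using e no_loops[OF e(1)] by simp
      ultimately have "apath u [e] v"
        by (auto simp: apath_def awalk_Cons_iff awalk_Nil_iff)
      then show ?thesis using R e by (intro exI[of _ "[e]"]) auto
    qed
  qed
  show ?thesis unfolding burning.simps mem_Collect_eq short ..
qed

lemma burning_subset_verts:
  "X0 \<subseteq> verts G \<Longrightarrow> burning G W X0 n \<subseteq> verts G"
proof (cases n)
  case (Suc m)
  then show ?thesis
    by (auto simp: burning_Suc_iff simp del: burning.simps(2) dest: adj_in_verts)
qed simp

text \<open>A burning vertex keeps burning through the trivial path: it lies in no earlier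
  \<open>W k\<close> because it caught fire, and not in the next one by disjointness.\<close>

lemma burning_subset_Suc:
  assumes "X0 \<subseteq> verts G" "\<And>n. burning G W X0 n \<inter> W (n + 1) = {}"
  shows "burning G W X0 n \<subseteq> burning G W X0 (Suc n)"
proof
  fix v assume v: "v \<in> burning G W X0 n"
  have "v \<notin> W k" if "k \<in> {1..n}" for k
  proof (cases n)
    case (Suc m)
    then show ?thesis using v that by (auto simp: burning_Suc_iff simp del: burning.simps(2))
  qed (use that in auto)
  moreover have "v \<notin> W (Suc n)" using assms(2)[of n] v by auto
  ultimately have "v \<notin> (\<Union>k\<in>{1..Suc n}. W k)"
    by (auto simp: le_Suc_eq)
  then show "v \<in> burning G W X0 (Suc n)"
    using v burning_subset_verts[OF assms(1), of W n]
    unfolding burning_Suc_iff by blast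
qed

lemma burning_mono:
  assumes "X0 \<subseteq> verts G" "\<And>n. burning G W X0 n \<inter> W (n + 1) = {}" "m \<le> n"
  shows "burning G W X0 m \<subseteq> burning G W X0 n"
  using lift_Suc_mono_le[of "burning G W X0", OF burning_subset_Suc[OF assms(1,2)] assms(3)] .

text \<open>The fire advances one arc per time step. Avoidance is required up to the final time
  \<open>m + length p\<close>, a quantity that stays fixed when an arc is consumed.\<close>

lemma burning_along_awalk:
  assumes "awalk u p v" "u \<in> burning G W X0 m"
    and "set (awalk_verts u p) \<inter> (\<Union>k\<in>{1..m + length p}. W k) = {}"
  shows "v \<in> burning G W X0 (m + length p)"
  using assms
proof (induction p arbitrary: u m)
  case Nil
  then show ?case by (auto simp: awalk_Nil_iff)
next
  case (Cons e p)
  from Cons.prems have e: "e \<in> arcs G" "tail G e = u" and w: "awalk (head G e) p v"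
    by (auto simp: awalk_Cons_iff)
  have avoid: "u \<notin> (\<Union>k\<in>{1..m + length (e # p)}. W k)"
    "set (awalk_verts (head G e) p) \<inter> (\<Union>k\<in>{1..m + length (e # p)}. W k) = {}"
    using Cons.prems(3) e by auto
  have "head G e \<in> set (awalk_verts (head G e) p)" using w by (cases p) (auto simp: awalk_Cons_iff)
  then have "head G e \<notin> (\<Union>k\<in>{1..m + length (e # p)}. W k)" using avoid(2) by blast
  moreover have "u \<rightarrow> head G e" using in_arcs_imp_in_arcs_ends[OF e(1)] e(2) by simp
  ultimately have "head G e \<in> burning G W X0 (Suc m)"
    using Cons.prems(2) avoid(1) unfolding burning_Suc_iff by (intro bexI[of _ u]) auto
  from Cons.IH[OF w this] avoid(2) show ?case by simp
qed

lemma burning_finite: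
  assumes "\<And>u. finite (out_arcs G u)" "finite X0"
  shows "finite (burning G W X0 n)"
proof (induction n)
  case (Suc n)
  have "burning G W X0 (Suc n) \<subseteq> closed_nbhd G (burning G W X0 n)"
    by (force simp: burning_Suc_iff closed_nbhd_def simp del: burning.simps(2))
  then show ?case by (rule finite_subset) (use Suc assms in \<open>auto simp: closed_nbhd_def\<close>)
qed (use assms in simp)

end

section \<open>Transfer of containment strategies along a coarse map\<close>

lemma increasing_bounded_stabilizes:
  fixes X :: "nat \<Rightarrow> 'a set"
  assumes "mono X" "finite B" "\<And>n. X n \<subseteq> B"
  shows "\<exists>N>0. \<forall>n\<ge>N. X n = X N"
proof -
  have fin: "finite (X n)" for n using assms finite_subset by blast
  have bdd: "\<forall>y. (\<exists>n. y = card (X n)) \<longrightarrow> y \<le> card B"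
    using assms card_mono by blast
  obtain m where m: "\<And>n. card (X n) \<le> card (X m)"
    using Greatest_le_nat[of "\<lambda>y. \<exists>n. y = card (X n)" _ "card B"]
      GreatestI_nat[of "\<lambda>y. \<exists>n. y = card (X n)" _ "card B"] bdd by metis
  have "X n = X m" if "n \<ge> m" for n
    using card_seteq[OF fin[of n] monoD[OF assms(1) that] m[of n]] by simp
  \<comment> \<open>\<open>m\<close> is a time of maximal cardinality; passing to
    \<open>Suc m\<close> secures a positive \<open>N\<close>.\<close>
  then have "X n = X (Suc m)" if "n \<ge> Suc m" for n using that by (metis Suc_leD le_Suc_eq)
  then show ?thesis by blast
qed

lemma card_vimage_le:
  assumes fib: "\<And>x. finite {z \<in> V. \<psi> z = x} \<and> card {z \<in> V. \<psi> z = x} \<le> M" and "finite S"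
  shows "finite {z \<in> V. \<psi> z \<in> S} \<and> card {z \<in> V. \<psi> z \<in> S} \<le> M * card S"
proof -
  have eq: "{z \<in> V. \<psi> z \<in> S} = (\<Union>x\<in>S. {z \<in> V. \<psi> z = x})" by auto
  have "card (\<Union>x\<in>S. {z \<in> V. \<psi> z = x}) \<le> (\<Sum>x\<in>S. card {z \<in> V. \<psi> z = x})"
    using \<open>finite S\<close> by (rule card_UN_le)
  also have "\<dots> \<le> card S * M"
    using sum_bounded_above[of S "\<lambda>x. card {z \<in> V. \<psi> z = x}" M] fib by simp
  finally show ?thesis unfolding eq using fib \<open>finite S\<close> by (simp add: mult.commute)
qed

text \<open>The factors of the new bound: \<open>K\<close> sets of size at most
  \<open>f (K * n)\<close> are united, passing to radius \<open>K\<close> costs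
  \<open>(D + 1) ^ K\<close>, and pulling back along \<open>\<psi>\<close> costs
  \<open>M\<close>.\<close>

lemma containment_property_pullback:
  fixes G :: "('a, 'b) pre_digraph" and H :: "('c, 'd) pre_digraph"
  assumes "simple_graph G" "simple_graph H"
    and deg: "\<And>u. finite (out_arcs G u) \<and> card (out_arcs G u) \<le> D"
    and \<psi>: "\<And>z. z \<in> verts H \<Longrightarrow> \<psi> z \<in> verts G"
    and adj: "\<And>z w. (z, w) \<in> arcs_ends H \<Longrightarrow>
                \<exists>p. pre_digraph.awalk G (\<psi> z) p (\<psi> w) \<and> length p \<le> K"
    and fib: "\<And>x. finite {z \<in> verts H. \<psi> z = x} \<and> card {z \<in> verts H. \<psi> z = x} \<le> M"
    and f: "mono_on {1..} f"
    and cont: "containment_property G f"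
  shows "containment_property H (\<lambda>n. M * ((D + 1) ^ K * (K * f (K * n))))"
  unfolding containment_property_def
proof (intro allI impI)
  interpret G: simple_graph G by fact
  interpret H: simple_graph H by fact
  fix X0 assume X0: "X0 \<subseteq> verts H \<and> finite X0"
  have Y0: "\<psi> ` X0 \<subseteq> verts G" "finite (\<psi> ` X0)" using X0 \<psi> by auto
  then obtain W where "containment_strategy G f (\<psi> ` X0) W"
    using cont by (auto simp: containment_property_def)
  then have W: "\<And>n. n \<ge> 1 \<Longrightarrow> finite (W n) \<and> card (W n) \<le> f n"
    and disj: "\<And>n. burning G W (\<psi> ` X0) n \<inter> W (n + 1) = {}"
    and "\<exists>N>0. \<forall>n\<ge>N. burning G W (\<psi> ` X0) n = burning G W (\<psi> ` X0) N"
    by (auto simp: containment_strategy_def)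
  then obtain N where N: "\<And>n. n \<ge> N \<Longrightarrow> burning G W (\<psi> ` X0) n = burning G W (\<psi> ` X0) N"
    by blast
  define Y where "Y = burning G W (\<psi> ` X0)"
  have Y_mono: "m \<le> n \<Longrightarrow> Y m \<subseteq> Y n" for m n
    unfolding Y_def by (rule G.burning_mono[OF Y0(1) disj])
  \<comment> \<open>For \<open>n \<ge> 1\<close> these are the \<open>K\<close> time steps in
    \<open>G\<close> matching step \<open>n\<close> in \<open>H\<close>; \<open>J 0\<close> is
    empty.\<close>
  define J where "J n = {K * (n - 1) + 1..K * n}" for n
  define B where "B n = (closed_nbhd G ^^ K) (\<Union>j\<in>J n. W j)" for n
  define W' where "W' n = {z \<in> verts H. \<psi> z \<in> B n \<and> \<psi> z \<notin> Y (K * (n - 1))}" for n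
  define X where "X = burning H W' X0"
  have X_verts: "X n \<subseteq> verts H" for n
    unfolding X_def using H.burning_subset_verts X0 by blast
  have inv: "\<psi> y \<in> Y (K * n)" if "y \<in> X n" for n y
    using that
  proof (induction n arbitrary: y)
    case 0
    then show ?case by (auto simp: X_def Y_def)
  next
    case (Suc n)
    then obtain x where x: "x \<in> X n" and xy: "x = y \<and> x \<in> verts H \<or> (x, y) \<in> arcs_ends H"
      and y: "y \<notin> (\<Union>k\<in>{1..Suc n}. W' k)"
      unfolding X_def H.burning_Suc_iff by blast
    have yV: "y \<in> verts H" using X_verts Suc.prems by blast
    have Yx: "\<psi> x \<in> Y (K * n)" using Suc.IH x by blast
    show ?case
    proof (cases "x = y")
      case True
      then show ?thesis using Yx Y_mono[of "K * n" "K * Suc n"] by auto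
    next
      case False
      then obtain p where p: "G.awalk (\<psi> x) p (\<psi> y)" "length p \<le> K"
        using xy adj by blast
      show ?thesis
      proof (cases "set (G.awalk_verts (\<psi> x) p) \<inter> (\<Union>k\<in>{1..K * n + length p}. W k) = {}")
        case True
        then have "\<psi> y \<in> Y (K * n + length p)"
          using G.burning_along_awalk[OF p(1)] Yx unfolding Y_def by simp
        then show ?thesis using Y_mono[of "K * n + length p" "K * Suc n"] p(2) by auto
      next
        case False
        then obtain j w where j: "j \<in> {1..K * n + length p}" "w \<in> W j"
          and w: "w \<in> set (G.awalk_verts (\<psi> x) p)" by blast
        obtain q r where "p = q @ r" "G.awalk w r (\<psi> y)"
          using G.awalk_decomp[OF p(1) w] by blast
        then have r: "G.awalk w r (\<psi> y)" "length r \<le> K" using p(2) by auto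
        define m where "m = (j - 1) div K"
        \<comment> \<open>For \<open>K = 0\<close> the walk would be empty and the blocking set
          could only come from time 0 of \<open>H\<close>, leaving no index
          \<open>j\<close>.\<close>
        have "K > 0" using j p(2) by (cases "K = 0") auto
        have "j \<le> K * Suc n" using j(1) p(2) by auto
        then have "j - 1 < K * Suc n" using j(1) by auto
        then have "m < Suc n" unfolding m_def using \<open>K > 0\<close>
          by (simp add: less_mult_imp_div_less mult.commute)
        have "K * m + (j - 1) mod K = j - 1" unfolding m_def by simp
        moreover have "(j - 1) mod K < K" using \<open>K > 0\<close> by simp
        \<comment> \<open>Blocks start at \<open>K * m + 1\<close>, hence the shift to
          \<open>j - 1\<close>. The block may be any one up to the current step, not only the
          latest.\<close>
        ultimately have "j \<in> J (Suc m)" using j(1) by (auto simp: J_def)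
        then have "\<psi> y \<in> B (Suc m)"
          unfolding B_def using G.awalk_in_closed_nbhd_iter[OF r] j(2) by blast
        moreover have "y \<notin> W' (Suc m)" using y \<open>m < Suc n\<close> by auto
        ultimately have "\<psi> y \<in> Y (K * m)" using yV by (simp add: W'_def)
        moreover have "K * m \<le> K * Suc n" using \<open>m < Suc n\<close> by (intro mult_le_mono2) simp
        ultimately show ?thesis using Y_mono by blast
      qed
    qed
  qed
  \<comment> \<open>This is where leaving out \<open>Y (K * (n - 1))\<close> from
    \<open>W' n\<close> pays off: \<open>inv\<close> puts the images of \<open>X n\<close> in
    exactly the excluded set.\<close>
  have disj': "X n \<inter> W' (n + 1) = {}" for n
    using inv by (auto simp: W'_def)
  have card: "finite (W' n) \<and> card (W' n) \<le> M * ((D + 1) ^ K * (K * f (K * n)))"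
    if "n \<ge> 1" for n
  proof -
    have fin: "finite (\<Union>j\<in>J n. W j)" using W by (auto simp: J_def)
    have "card (\<Union>j\<in>J n. W j) \<le> (\<Sum>j\<in>J n. card (W j))"
      by (rule card_UN_le) (simp add: J_def)
    also have "\<dots> \<le> card (J n) * f (K * n)"
    proof -
      have "card (W j) \<le> f (K * n)" if "j \<in> J n" for j
      proof -
        have "1 \<le> j" "j \<le> K * n" using that by (auto simp: J_def)
        moreover from this have "1 \<le> K * n" by linarith
        ultimately have "f j \<le> f (K * n)" by (intro mono_onD[OF f]) (simp_all only: atLeast_iff)
        then show ?thesis using W[OF \<open>1 \<le> j\<close>] by simp
      qed
      then show ?thesis
        using sum_bounded_above[of "J n" "\<lambda>j. card (W j)" "f (K * n)"] by simp
    qed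
    also have "card (J n) = K"
      using that by (cases n) (auto simp: J_def)
    finally have "card (B n) \<le> (D + 1) ^ K * (K * f (K * n))" and finB: "finite (B n)"
      using closed_nbhd_iter_card[OF deg fin, of K] unfolding B_def
      by (auto intro: order_trans mult_le_mono2)
    moreover have pre: "finite {z \<in> verts H. \<psi> z \<in> B n}"
      "card {z \<in> verts H. \<psi> z \<in> B n} \<le> M * card (B n)"
      using card_vimage_le[OF fib finB] by auto
    moreover have sub: "W' n \<subseteq> {z \<in> verts H. \<psi> z \<in> B n}" by (auto simp: W'_def)
    ultimately show ?thesis
      using finite_subset[OF sub pre(1)] card_mono[OF pre(1) sub]
      by (meson mult_le_mono2 order_trans)
  qed
  have "mono X"
    unfolding X_def
    by (rule monoI, rule H.burning_mono) (use X0 disj' in \<open>auto simp: X_def\<close>)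
  moreover have "finite {z \<in> verts H. \<psi> z \<in> Y N}"
    using card_vimage_le[OF fib, of "Y N"] G.burning_finite[OF _ Y0(2)] deg
    unfolding Y_def by blast
  moreover have "X n \<subseteq> {z \<in> verts H. \<psi> z \<in> Y N}" for n
  proof
    fix z assume z: "z \<in> X n"
    have "Y (K * n) \<subseteq> Y N"
      \<comment> \<open>The maximum covers times \<open>K * n\<close> both before and after
        \<open>N\<close>.\<close>
      using Y_mono[of "K * n" "max N (K * n)"] N[of "max N (K * n)"] unfolding Y_def by simp
    then show "z \<in> {z \<in> verts H. \<psi> z \<in> Y N}" using z inv X_verts by blast
  qed
  ultimately have "\<exists>N>0. \<forall>n\<ge>N. X n = X N" by (rule increasing_bounded_stabilizes)
  moreover have "W' n \<subseteq> verts H" for n by (auto simp: W'_def)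
  ultimately have "containment_strategy H (\<lambda>n. M * ((D + 1) ^ K * (K * f (K * n)))) X0 W'"
    unfolding containment_strategy_def using card disj' unfolding X_def by blast
  then show "\<exists>W. containment_strategy H (\<lambda>n. M * ((D + 1) ^ K * (K * f (K * n)))) X0 W"
    by (rule exI[of _ W'])
qed

section \<open>Extracting the coarse map from a quasi-isometry\<close>

text \<open>Let \<open>\<psi> z\<close> be a point whose image under \<open>\<phi>\<close> is within
  \<open>c\<close> of \<open>z\<close>. The lower quasi-isometry bound controls walks between images
  of neighbours, and a fibre over \<open>x\<close> lies in the ball of radius \<open>c\<close>
  around \<open>\<phi> x\<close>.\<close>

lemma quasi_inverse:
  assumes "simple_graph G" "Digraph_Component.connected G"
    and "simple_graph H" "Digraph_Component.connected H" "bounded_degree H"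
    and "quasi_isometric (verts G) (graph_dist G) (verts H) (graph_dist H)"
  obtains \<psi> K M where "K > 0" "M > 0" "\<And>z. z \<in> verts H \<Longrightarrow> \<psi> z \<in> verts G"
    "\<And>z w. (z, w) \<in> arcs_ends H \<Longrightarrow>
       \<exists>p. pre_digraph.awalk G (\<psi> z) p (\<psi> w) \<and> length p \<le> K"
    "\<And>x. finite {z \<in> verts H. \<psi> z = x} \<and> card {z \<in> verts H. \<psi> z = x} \<le> M"
proof -
  interpret G: simple_graph G by fact
  interpret H: simple_graph H by fact
  interpret MH: Metric_space "verts H" "graph_dist H"
    by (rule H.Metric_space_graph_dist) fact
  obtain \<phi> L \<epsilon> c where \<phi>: "\<phi> \<in> verts G \<rightarrow> verts H" and bounds: "L \<ge> 1" "\<epsilon> \<ge> 0" "c \<ge> 0"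
    and lower: "\<And>x y. x \<in> verts G \<Longrightarrow> y \<in> verts G \<Longrightarrow>
      1 / L * graph_dist G x y - \<epsilon> \<le> graph_dist H (\<phi> x) (\<phi> y)"
    and dense: "\<forall>z \<in> verts H. \<exists>x \<in> verts G. graph_dist H z (\<phi> x) \<le> c"
    using assms(6) unfolding quasi_isometric_def by blast
  obtain \<psi> where \<psi>: "\<And>z. z \<in> verts H \<Longrightarrow> \<psi> z \<in> verts G"
    "\<And>z. z \<in> verts H \<Longrightarrow> graph_dist H z (\<phi> (\<psi> z)) \<le> c"
    using dense by metis
  \<comment> \<open>Neighbours \<open>z\<close>, \<open>w\<close> have
    \<open>\<phi> (\<psi> z)\<close> and \<open>\<phi> (\<psi> w)\<close> at distance at most
    \<open>2 * c + 1\<close>; solving the lower bound for the distance in \<open>G\<close> gives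
    this value. \<open>Suc\<close> makes positivity immediate.\<close>
  define K where "K = Suc (nat \<lceil>L * (2 * c + 1 + \<epsilon>)\<rceil>)"
  obtain D where deg: "\<And>u. finite (out_arcs H u) \<and> card (out_arcs H u) \<le> D"
    using bounded_degreeE[OF H.wf_digraph_axioms assms(5)] by blast
  define k where "k = nat \<lceil>c\<rceil>"
  have adj: "\<exists>p. G.awalk (\<psi> z) p (\<psi> w) \<and> length p \<le> K" if zw: "(z, w) \<in> arcs_ends H" for z w
  proof -
    have V: "z \<in> verts H" "w \<in> verts H" using zw H.adj_in_verts by auto
    then have V': "\<psi> z \<in> verts G" "\<psi> w \<in> verts G" using \<psi> by auto
    then have V'': "\<phi> (\<psi> z) \<in> verts H" "\<phi> (\<psi> w) \<in> verts H" using \<phi> by auto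
    have "graph_dist H (\<phi> (\<psi> z)) (\<phi> (\<psi> w))
        \<le> graph_dist H (\<phi> (\<psi> z)) z + graph_dist H z (\<phi> (\<psi> w))"
      using MH.triangle V V'' by blast
    also have "graph_dist H z (\<phi> (\<psi> w)) \<le> graph_dist H z w + graph_dist H w (\<phi> (\<psi> w))"
      using MH.triangle V V'' by blast
    finally have "graph_dist H (\<phi> (\<psi> z)) (\<phi> (\<psi> w)) \<le> 2 * c + 1"
      using \<psi>(2)[OF V(1)] \<psi>(2)[OF V(2)] H.graph_dist_adjacent_le[OF zw]
        MH.commute[of "\<phi> (\<psi> z)" z] by linarith
    with lower[OF V'] have "1 / L * graph_dist G (\<psi> z) (\<psi> w) \<le> 2 * c + 1 + \<epsilon>" by linarith
    then have "graph_dist G (\<psi> z) (\<psi> w) \<le> L * (2 * c + 1 + \<epsilon>)"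
      using bounds by (simp add: field_simps)
    also have "\<dots> \<le> real K" unfolding K_def by linarith
    finally have "graph_dist G (\<psi> z) (\<psi> w) \<le> real K" .
    moreover obtain p where "G.awalk (\<psi> z) p (\<psi> w)"
      "real (length p) = graph_dist G (\<psi> z) (\<psi> w)"
      using G.connected_awalk_graph_dist[OF assms(2) V'] by blast
    ultimately show ?thesis by auto
  qed
  have fib: "finite {z \<in> verts H. \<psi> z = x} \<and> card {z \<in> verts H. \<psi> z = x} \<le> (D + 1) ^ k" for x
  proof -
    let ?B = "(closed_nbhd H ^^ k) {\<phi> x}"
    have B: "finite ?B" "card ?B \<le> (D + 1) ^ k"
      using closed_nbhd_iter_card[OF deg, of "{\<phi> x}" k] by auto
    have "{z \<in> verts H. \<psi> z = x} \<subseteq> ?B"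
    proof
      fix z assume "z \<in> {z \<in> verts H. \<psi> z = x}"
      then have z: "z \<in> verts H" "\<psi> z = x" by auto
      then have "\<phi> x \<in> verts H" using \<psi> \<phi> by auto
      then obtain p where p: "H.awalk (\<phi> x) p z" "real (length p) = graph_dist H (\<phi> x) z"
        using H.connected_awalk_graph_dist[OF assms(4) _ z(1)] by blast
      have "graph_dist H (\<phi> x) z \<le> c" using \<psi>(2)[OF z(1)] z(2) MH.commute by simp
      then have "length p \<le> k" using p(2) unfolding k_def by linarith
      with p(1) show "z \<in> ?B" by (rule H.awalk_in_closed_nbhd_iter) simp
    qed
    then show ?thesis using B by (meson card_mono finite_subset order_trans)
  qed
  have "K > 0" "(D + 1) ^ k > 0" by (simp_all add: K_def)
  from that[OF this \<psi>(1) adj fib] show ?thesis .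
qed

section \<open>Growth of the new sequence and conclusion\<close>

lemma growth_equivalent_rescale:
  assumes f: "mono_on {1..} f" and "C > 0" "K > 0"
  shows "growth_equivalent (\<lambda>n. C * f (K * n)) f"
proof -
  have "growth_le (\<lambda>n. C * f (K * n)) f"
    unfolding growth_le_def
  \<comment> \<open>One constant must dominate both the factor \<open>C\<close> and the dilation
    \<open>K\<close>.\<close>
  proof (intro exI[of _ "C + K"] conjI allI impI)
    fix n assume n: "C + K \<le> n"
    have "1 \<le> K * n" using n assms by (simp add: Suc_le_eq)
    moreover have "K * n \<le> (C + K) * n + (C + K)" by (simp add: algebra_simps)
    ultimately have "f (K * n) \<le> f ((C + K) * n + (C + K))"
      by (intro mono_onD[OF f]) auto
    then have "C * f (K * n) \<le> (C + K) * f ((C + K) * n + (C + K))"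
      by (intro mult_le_mono) auto
    then show "C * f (K * n) \<le> (C + K) * f ((C + K) * n + (C + K)) + (C + K)" by simp
  qed (use assms in simp)
  moreover have "growth_le f (\<lambda>n. C * f (K * n))"
    unfolding growth_le_def
  \<comment> \<open>Constant 1 suffices: \<open>C\<close> and \<open>K\<close> are at least 1 and
    \<open>f\<close> is monotone.\<close>
  proof (intro exI[of _ 1] conjI allI impI)
    fix n :: nat assume n: "1 \<le> n"
    have "n \<le> K * (1 * n + 1)" using assms by (cases K) auto
    then have "f n \<le> f (K * (1 * n + 1))" using n by (intro mono_onD[OF f]) auto
    also have "\<dots> \<le> C * f (K * (1 * n + 1))" using assms by simp
    finally show "f n \<le> 1 * (C * f (K * (1 * n + 1))) + 1" by simp
  qed simp
  ultimately show ?thesis by (simp add: growth_equivalent_def)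
qed

theorem theorem4p4:
  fixes G :: "('a, 'b) pre_digraph"
    and H :: "('c, 'd) pre_digraph"
    and f :: "nat \<Rightarrow> nat"
  assumes "simple_graph G" "Digraph_Component.connected G" "bounded_degree G"
    and "simple_graph H" "Digraph_Component.connected H" "bounded_degree H"
    and "quasi_isometric (verts G) (graph_dist G) (verts H) (graph_dist H)"
    and "mono_on {1..} f"
    and "containment_property G f"
  shows "\<exists>b :: nat \<Rightarrow> nat. mono_on {1..} b \<and> containment_property H b \<and> growth_equivalent b f"
proof -
  interpret G: simple_graph G by fact
  obtain D where deg: "\<And>u. finite (out_arcs G u) \<and> card (out_arcs G u) \<le> D"
    using bounded_degreeE[OF G.wf_digraph_axioms assms(3)] by blast
  obtain \<psi> K M where pos: "K > 0" "M > 0" and \<psi>: "\<And>z. z \<in> verts H \<Longrightarrow> \<psi> z \<in> verts G"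
    "\<And>z w. (z, w) \<in> arcs_ends H \<Longrightarrow> \<exists>p. G.awalk (\<psi> z) p (\<psi> w) \<and> length p \<le> K"
    "\<And>x. finite {z \<in> verts H. \<psi> z = x} \<and> card {z \<in> verts H. \<psi> z = x} \<le> M"
    by (rule quasi_inverse[OF assms(1,2,4,5,6,7)]) blast
  define C where "C = M * ((D + 1) ^ K * K)"
  have "C > 0" using pos by (simp add: C_def)
  have "containment_property H (\<lambda>n. C * f (K * n))"
    using containment_property_pullback[OF assms(1,4) deg \<psi> assms(8,9)]
    by (simp add: C_def mult.assoc)
  moreover have "mono_on {1..} (\<lambda>n. C * f (K * n))"
    using pos by (intro mono_onI mult_le_mono2 mono_onD[OF assms(8)]) (auto simp: Suc_le_eq)
  ultimately show ?thesis
    using growth_equivalent_rescale[OF assms(8) \<open>C > 0\<close> pos(1)] by blast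
qed

end
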